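(* Let $S$ be a commutative semiring with $1\neq 0$, let $M$ be a unital $S$-semimodule, and let $N$ be a proper subtractive subsemimodule of $M$. Then the following statements are equivalent: (1) $N$ is a weakly $1$-absorbing prime subsemimodule of $M$. (2) For all nonunits $a,b\in S$ with $ab\notin (N:_S M)$, $(N:_M ab)=(0:_M ab)\cup N$. (3) For all nonunits $a,b\in S$ with $ab\notin (N:_S M)$, $(N:_M ab)=(0:_M ab)$ or $(N:_M ab)=N$. (4) For all nonunits $a,b\in S$ and every subsemimodule $K$ of $M$ with $0\neq abK\subseteq N$, either $ab\in (N:_S M)$ or $K\subseteq N$. (5) For every nonunit $a\in S$, every proper ideal $J$ of $S$, and every subsemimodule $K$ of $M$ with $0\neq aJK\subseteq N$, either $aJ\subseteq (N:_S M)$ or $K\subseteq N$. (6) For all proper ideals $I,J$ of $S$ and every subsemimodule $K$ of $M$ with $0\neq IJK\subseteq N$, either $IJ\subseteq (N:_S M)$ or $K\subseteq N$.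
   Context: For a subsemimodule $N$ of $M$, $(N:_S M)=\{s\in S\mid sM\subseteq N\}$, an ideal of $S$. For $c\in S$, $(N:_M c)=\{m\in M\mid cm\in N\}$ and $(0:_M c)=\{m\in M\mid cm=0\}$. $N$ is subtractive if for all $x,y\in M$, $x\in N$ and $x+y\in N$ imply $y\in N$. A proper subsemimodule $N$ of $M$ is weakly $1$-absorbing prime if for all nonunits $a,b\in S$ and all $m\in M$, $0\neq abm\in N$ implies $ab\in (N:_S M)$ or $m\in N$. Products such as $IJ$, $aJK$ and $IJK$ denote the ideal or subsemimodule of finite sums of products of elements; $0\neq IJK$ means $IJK$ is not the zero subsemimodule (similarly for $abK$ and $aJK$). *)

theory Defs
  imports Main
begin

text \<open>
  Commutative semirings with \<open>1 \<noteq> 0\<close> are the types of class \<^class>\<open>comm_semiring_1\<close> (in which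
  \<open>0\<close> is absorbing). The locale \<open>module\<close> of \<open>HOL.Modules\<close> needs negatives in the scalars and
  in the module; \<open>semimodule\<close> keeps its axioms and adds the two zero laws that no longer follow
  from them.
\<close>

locale semimodule =
  fixes scale :: "'s::comm_semiring_1 \<Rightarrow> 'm::comm_monoid_add \<Rightarrow> 'm"  (infixr "*s" 75)
  assumes scale_right_distrib: "a *s (x + y) = a *s x + a *s y"
    and scale_left_distrib: "(a + b) *s x = a *s x + b *s x"
    and scale_scale: "a *s (b *s x) = (a * b) *s x"
    and scale_one: "1 *s x = x"
    and scale_zero_left: "0 *s x = 0"
    and scale_zero_right: "a *s 0 = 0"

definition semiring_ideal :: "'s::comm_semiring_1 set \<Rightarrow> bool" where
  "semiring_ideal I \<longleftrightarrow>
     0 \<in> I \<and> (\<forall>x\<in>I. \<forall>y\<in>I. x + y \<in> I) \<and> (\<forall>s. \<forall>x\<in>I. s * x \<in> I)"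

definition proper_ideal :: "'s::comm_semiring_1 set \<Rightarrow> bool" where
  "proper_ideal I \<longleftrightarrow> semiring_ideal I \<and> I \<noteq> UNIV"

definition nonunit :: "'s::comm_semiring_1 \<Rightarrow> bool" where
  "nonunit a \<longleftrightarrow> \<not> a dvd 1"

definition subsemimodule ::
    "('s::comm_semiring_1 \<Rightarrow> 'm::comm_monoid_add \<Rightarrow> 'm) \<Rightarrow> 'm set \<Rightarrow> bool" where
  "subsemimodule scale N \<longleftrightarrow>
     0 \<in> N \<and> (\<forall>x\<in>N. \<forall>y\<in>N. x + y \<in> N) \<and> (\<forall>s. \<forall>x\<in>N. scale s x \<in> N)"

definition proper_subsemimodule ::
    "('s::comm_semiring_1 \<Rightarrow> 'm::comm_monoid_add \<Rightarrow> 'm) \<Rightarrow> 'm set \<Rightarrow> bool" where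
  "proper_subsemimodule scale N \<longleftrightarrow> subsemimodule scale N \<and> N \<noteq> UNIV"

definition subtractive :: "'m::comm_monoid_add set \<Rightarrow> bool" where
  "subtractive N \<longleftrightarrow> (\<forall>x y. x \<in> N \<and> x + y \<in> N \<longrightarrow> y \<in> N)"

text \<open>\<open>colon_S scale N\<close> is \<open>(N :\<^sub>S M)\<close> and \<open>colon_M scale N c\<close> is \<open>(N :\<^sub>M c)\<close>;
  in particular \<open>(0 :\<^sub>M c)\<close> is \<open>colon_M scale {0} c\<close>.\<close>

definition colon_S ::
    "('s::comm_semiring_1 \<Rightarrow> 'm::comm_monoid_add \<Rightarrow> 'm) \<Rightarrow> 'm set \<Rightarrow> 's set" where
  "colon_S scale N = {s. range (scale s) \<subseteq> N}"

definition colon_M ::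
    "('s::comm_semiring_1 \<Rightarrow> 'm::comm_monoid_add \<Rightarrow> 'm) \<Rightarrow> 'm set \<Rightarrow> 's \<Rightarrow> 'm set" where
  "colon_M scale N c = {m. scale c m \<in> N}"

definition weakly_1_absorbing_prime ::
    "('s::comm_semiring_1 \<Rightarrow> 'm::comm_monoid_add \<Rightarrow> 'm) \<Rightarrow> 'm set \<Rightarrow> bool" where
  "weakly_1_absorbing_prime scale N \<longleftrightarrow>
     proper_subsemimodule scale N \<and>
     (\<forall>a b m. nonunit a \<longrightarrow> nonunit b \<longrightarrow>
        scale (a * b) m \<noteq> 0 \<longrightarrow> scale (a * b) m \<in> N \<longrightarrow>
        a * b \<in> colon_S scale N \<or> m \<in> N)"

text \<open>Finite sums of elements of \<open>A\<close>; the empty sum \<open>0\<close> is included.\<close>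

definition finite_sums :: "'a::comm_monoid_add set \<Rightarrow> 'a set" where
  "finite_sums A = {sum_list xs |xs. set xs \<subseteq> A}"

text \<open>\<open>IJ\<close> and \<open>IJK\<close>. A single element is passed as a singleton set: \<open>aJ\<close> is
  \<open>prod_ideal {a} J\<close>, \<open>aJK\<close> is \<open>prod3 scale {a} J K\<close>, and \<open>abK\<close> is \<open>prod3 scale {a} {b} K\<close>.\<close>

definition prod_ideal :: "'s::comm_semiring_1 set \<Rightarrow> 's set \<Rightarrow> 's set" where
  "prod_ideal I J = finite_sums {i * j |i j. i \<in> I \<and> j \<in> J}"

definition prod3 ::
    "('s::comm_semiring_1 \<Rightarrow> 'm::comm_monoid_add \<Rightarrow> 'm) \<Rightarrow> 's set \<Rightarrow> 's set \<Rightarrow> 'm set \<Rightarrow> 'm set"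
  where
  "prod3 scale I J K = finite_sums {scale (i * j) k |i j k. i \<in> I \<and> j \<in> J \<and> k \<in> K}"

end

theory Submission
  imports Defs
begin

text \<open>
  The six properties form a cycle of implications: from the weakly 1-absorbing prime property
  through the two descriptions of \<open>(N :\<^sub>M ab)\<close> and the statements about \<open>abK\<close>, \<open>aJK\<close> and
  \<open>IJK\<close>, back to the first.

  Each time a condition on elements is promoted to one on a larger object, the same obstruction
  appears: for every single element one of two alternatives holds, but the alternative may
  depend on the element. An element of \<open>(N :\<^sub>M ab)\<close> is killed by \<open>ab\<close> or lies in
  \<open>N\<close>; if \<open>K\<close> is not contained in \<open>N\<close> and \<open>IJK \<subseteq> N\<close>, then an element \<open>j\<close> of
  \<open>J\<close> satisfies \<open>ajK = 0\<close> or \<open>aj \<in> (N :\<^sub>S M)\<close> for a fixed \<open>a\<close> in \<open>I\<close>, and an element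
  \<open>i\<close> of \<open>I\<close> satisfies \<open>iJK = 0\<close> or \<open>iJ \<subseteq> (N :\<^sub>S M)\<close>. In all three cases both
  alternatives define subtractive sets, and an additively closed set covered by two subtractive
  sets lies inside one of them, just as a group is not the union of two proper subgroups
  (\<open>covered_by_two_subtractive\<close>). Hence one alternative holds uniformly. The hypothesis that
  \<open>N\<close> is subtractive enters exactly here; \<open>{0}\<close> is always subtractive.

  The two scalar cases are one statement, \<open>absorbing_elements_imp_absorbing_set\<close>, applied
  first to \<open>J\<close> with the other factor a single element and then to \<open>I\<close> with the other
  factor \<open>J\<close>. It meets the conditions on nonunits because an element of a proper ideal is a
  nonunit; conversely a nonunit generates a proper ideal, which lets the statement about \<open>IJK\<close>
  return to elements.
\<close>

section \<open>Finite sums and subtractive sets\<close>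

lemma finite_sums_superset: "A \<subseteq> finite_sums A"
proof
  fix x assume "x \<in> A"
  then have "x = sum_list [x] \<and> set [x] \<subseteq> A" by simp
  then show "x \<in> finite_sums A" unfolding finite_sums_def by blast
qed

lemma finite_sums_subset_iff:
  assumes "0 \<in> P" and "\<And>x y. x \<in> P \<Longrightarrow> y \<in> P \<Longrightarrow> x + y \<in> P"
  shows "finite_sums A \<subseteq> P \<longleftrightarrow> A \<subseteq> P"
proof
  assume "finite_sums A \<subseteq> P"
  then show "A \<subseteq> P" using finite_sums_superset by blast
next
  assume A: "A \<subseteq> P"
  have "sum_list xs \<in> P" if "set xs \<subseteq> A" for xs
    using that A assms by (induction xs) auto
  then show "finite_sums A \<subseteq> P" unfolding finite_sums_def by blast
qed

lemma finite_sums_eq_zero_iff: "finite_sums A = {0} \<longleftrightarrow> A \<subseteq> {0}"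
proof -
  have "sum_list [] \<in> finite_sums A"
    unfolding finite_sums_def by (intro CollectI exI[of _ "[]"]) simp
  then have "finite_sums A = {0} \<longleftrightarrow> finite_sums A \<subseteq> {0}" by auto
  also have "\<dots> \<longleftrightarrow> A \<subseteq> {0}" by (rule finite_sums_subset_iff) auto
  finally show ?thesis .
qed

text \<open>
  If \<open>x \<in> X\<close> is missing from \<open>A\<close> and \<open>y \<in> X\<close> is missing from \<open>B\<close>, then
  \<open>x \<in> B\<close> and \<open>y \<in> A\<close>; the sum \<open>x + y\<close> can then be in neither of the two sets, since
  subtractivity would cancel the summand that already lies there.
\<close>

lemma covered_by_two_subtractive:
  assumes add: "\<And>x y. x \<in> X \<Longrightarrow> y \<in> X \<Longrightarrow> x + y \<in> X"
    and cover: "X \<subseteq> A \<union> B"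
    and A: "subtractive A" and B: "subtractive B"
  shows "X \<subseteq> A \<or> X \<subseteq> B"
proof (rule ccontr)
  assume "\<not> (X \<subseteq> A \<or> X \<subseteq> B)"
  then obtain x y where x: "x \<in> X" "x \<notin> A" and y: "y \<in> X" "y \<notin> B" by blast
  then have "x \<in> B" "y \<in> A" "x + y \<in> A \<or> x + y \<in> B" using cover add by blast+
  moreover have "x + y = y + x" by (rule add.commute)
  ultimately show False using x y A B unfolding subtractive_def by metis
qed

lemma subtractive_zero: "subtractive {0}"
  by (auto simp: subtractive_def)

section \<open>Ideals, colons and products\<close>

lemma proper_ideal_nonunit:
  assumes "proper_ideal I" and "x \<in> I"
  shows "nonunit x"
  unfolding nonunit_def
proof
  assume "x dvd 1"
  then obtain y where y: "1 = x * y" by (auto elim: dvdE)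
  have "s \<in> I" for s
  proof -
    have "(s * y) * x \<in> I" using assms by (auto simp: proper_ideal_def semiring_ideal_def)
    moreover have "(s * y) * x = s" using y by (metis mult.assoc mult.commute mult_1_right)
    ultimately show ?thesis by simp
  qed
  then show False using assms by (auto simp: proper_ideal_def)
qed

lemma proper_principal_ideal:
  assumes "nonunit a"
  shows "proper_ideal (range (\<lambda>s. s * a))"
proof -
  have "1 \<notin> range (\<lambda>s. s * a)"
    using assms unfolding nonunit_def by (metis dvd_triv_right rangeE)
  moreover have "semiring_ideal (range (\<lambda>s. s * a))"
    unfolding semiring_ideal_def
  proof (intro conjI ballI allI)
    show "0 \<in> range (\<lambda>s. s * a)" by (rule range_eqI[of _ _ 0]) simp
    fix x t assume "x \<in> range (\<lambda>s. s * a)"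
    then obtain u where x: "x = u * a" by blast
    show "t * x \<in> range (\<lambda>s. s * a)"
      by (rule range_eqI[of _ _ "t * u"]) (simp add: x mult.assoc)
    fix y assume "y \<in> range (\<lambda>s. s * a)"
    then obtain v where y: "y = v * a" by blast
    show "x + y \<in> range (\<lambda>s. s * a)"
      by (rule range_eqI[of _ _ "u + v"]) (simp add: x y distrib_right)
  qed
  ultimately show ?thesis by (auto simp: proper_ideal_def)
qed

context semimodule
begin

lemma mem_colon_S: "s \<in> colon_S scale N \<longleftrightarrow> (\<forall>m. s *s m \<in> N)"
  by (auto simp: colon_S_def)

lemma prod3_eq_zero_iff:
  "prod3 scale I J K = {0} \<longleftrightarrow> (\<forall>i\<in>I. \<forall>j\<in>J. \<forall>k\<in>K. (i * j) *s k = 0)"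
  unfolding prod3_def finite_sums_eq_zero_iff by blast

lemma prod3_subset_iff:
  assumes "subsemimodule scale N"
  shows "prod3 scale I J K \<subseteq> N \<longleftrightarrow> (\<forall>i\<in>I. \<forall>j\<in>J. \<forall>k\<in>K. (i * j) *s k \<in> N)"
proof -
  have "prod3 scale I J K \<subseteq> N \<longleftrightarrow> {(i * j) *s k |i j k. i \<in> I \<and> j \<in> J \<and> k \<in> K} \<subseteq> N"
    unfolding prod3_def
    by (rule finite_sums_subset_iff) (use assms in \<open>auto simp: subsemimodule_def\<close>)
  then show ?thesis by blast
qed

lemma prod_ideal_subset_colon_iff:
  assumes "subsemimodule scale N"
  shows "prod_ideal I J \<subseteq> colon_S scale N \<longleftrightarrow> (\<forall>i\<in>I. \<forall>j\<in>J. i * j \<in> colon_S scale N)"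
proof -
  have "prod_ideal I J \<subseteq> colon_S scale N \<longleftrightarrow>
      {i * j |i j. i \<in> I \<and> j \<in> J} \<subseteq> colon_S scale N"
    unfolding prod_ideal_def
    by (rule finite_sums_subset_iff)
      (use assms in \<open>auto simp: subsemimodule_def mem_colon_S scale_zero_left scale_left_distrib\<close>)
  then show ?thesis by blast
qed

text \<open>
  The scalars that multiply given products into a subtractive set form a subtractive set. For
  \<open>T = {0}\<close> these are annihilators, for \<open>T = N\<close> and \<open>K = UNIV\<close> they are colons into
  \<open>(N :\<^sub>S M)\<close>: the two alternatives to which the covering lemma is applied.
\<close>

lemma subtractive_scalars_into:
  assumes "subtractive T"
  shows "subtractive {c. \<forall>j\<in>J. \<forall>k\<in>K. (c * j) *s k \<in> T}"
proof -
  have cancel: "y \<in> T" if "x \<in> T" "x + y \<in> T" for x y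
    using assms that unfolding subtractive_def by blast
  show ?thesis
    unfolding subtractive_def by (simp add: distrib_right scale_left_distrib) (metis cancel)
qed

lemma subtractive_colon_zero: "subtractive (colon_M scale {0} c)"
  by (auto simp: subtractive_def colon_M_def scale_right_distrib)

lemma colon_zero_subset:
  assumes "subsemimodule scale N"
  shows "colon_M scale {0} c \<subseteq> colon_M scale N c"
  using assms by (auto simp: colon_M_def subsemimodule_def)

lemma subset_colon:
  assumes "subsemimodule scale N"
  shows "N \<subseteq> colon_M scale N c"
  using assms by (auto simp: colon_M_def subsemimodule_def)

lemma subsemimodule_cyclic: "subsemimodule scale (range (\<lambda>s. s *s m))"
  unfolding subsemimodule_def
proof (intro conjI ballI allI)
  show "0 \<in> range (\<lambda>s. s *s m)" by (rule range_eqI[of _ _ 0]) (simp add: scale_zero_left)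
  fix x t assume "x \<in> range (\<lambda>s. s *s m)"
  then obtain u where x: "x = u *s m" by blast
  show "t *s x \<in> range (\<lambda>s. s *s m)"
    by (rule range_eqI[of _ _ "t * u"]) (simp add: x scale_scale)
  fix y assume "y \<in> range (\<lambda>s. s *s m)"
  then obtain v where y: "y = v *s m" by blast
  show "x + y \<in> range (\<lambda>s. s *s m)"
    by (rule range_eqI[of _ _ "u + v"]) (simp add: x y scale_left_distrib)
qed

section \<open>From elements to ideals and back\<close>

lemma colon_eq_union:
  assumes weak: "weakly_1_absorbing_prime scale N"
    and "nonunit a" "nonunit b" "a * b \<notin> colon_S scale N"
  shows "colon_M scale N (a * b) = colon_M scale {0} (a * b) \<union> N"
proof
  have "subsemimodule scale N"
    using weak by (simp add: weakly_1_absorbing_prime_def proper_subsemimodule_def)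
  then show "colon_M scale {0} (a * b) \<union> N \<subseteq> colon_M scale N (a * b)"
    using colon_zero_subset subset_colon by blast
  show "colon_M scale N (a * b) \<subseteq> colon_M scale {0} (a * b) \<union> N"
    using assms unfolding weakly_1_absorbing_prime_def colon_M_def by blast
qed

lemma colon_union_imp_eq:
  assumes N: "subsemimodule scale N" "subtractive N"
    and union: "colon_M scale N c = colon_M scale {0} c \<union> N"
  shows "colon_M scale N c = colon_M scale {0} c \<or> colon_M scale N c = N"
proof -
  have "colon_M scale N c \<subseteq> colon_M scale {0} c \<or> colon_M scale N c \<subseteq> N"
  proof (rule covered_by_two_subtractive)
    show "x + y \<in> colon_M scale N c"
      if "x \<in> colon_M scale N c" "y \<in> colon_M scale N c" for x y
      using that N by (auto simp: colon_M_def subsemimodule_def scale_right_distrib)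
  qed (use union N subtractive_colon_zero in auto)
  then show ?thesis using colon_zero_subset[OF N(1)] subset_colon[OF N(1)] by blast
qed

lemma colon_dichotomy_imp_absorbing_subsemimodules:
  assumes N: "subsemimodule scale N"
    and dich: "colon_M scale N (a * b) = colon_M scale {0} (a * b) \<or> colon_M scale N (a * b) = N"
    and nz: "prod3 scale {a} {b} K \<noteq> {0}" and sub: "prod3 scale {a} {b} K \<subseteq> N"
  shows "K \<subseteq> N"
proof -
  have "K \<subseteq> colon_M scale N (a * b)"
    using sub by (auto simp: prod3_subset_iff[OF N] colon_M_def)
  moreover have "\<not> K \<subseteq> colon_M scale {0} (a * b)"
    using nz by (auto simp: prod3_eq_zero_iff colon_M_def)
  ultimately show ?thesis using dich by auto
qed

text \<open>
  Suppose \<open>K\<close> is not contained in \<open>N\<close>. Every element \<open>j\<close> of the additively closed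
  \<open>J\<close> then satisfies \<open>jXK = 0\<close> or \<open>jX \<subseteq> (N :\<^sub>S M)\<close>. Both conditions cut out subtractive
  sets of scalars, so one of them holds for all \<open>j\<close> at once, and it is not the first because
  \<open>JXK \<noteq> 0\<close>. With \<open>X = {a}\<close> this promotes single elements to an ideal in one factor; with
  \<open>X\<close> an ideal, it does the same for the other factor.
\<close>

lemma absorbing_elements_imp_absorbing_set:
  assumes N: "subsemimodule scale N" "subtractive N"
    and J: "\<And>x y. x \<in> J \<Longrightarrow> y \<in> J \<Longrightarrow> x + y \<in> J"
    and each: "\<And>j. j \<in> J \<Longrightarrow> prod3 scale {j} X K \<noteq> {0} \<Longrightarrow> prod3 scale {j} X K \<subseteq> N \<Longrightarrow>
      prod_ideal {j} X \<subseteq> colon_S scale N \<or> K \<subseteq> N"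
    and nz: "prod3 scale J X K \<noteq> {0}" and sub: "prod3 scale J X K \<subseteq> N"
  shows "prod_ideal J X \<subseteq> colon_S scale N \<or> K \<subseteq> N"
proof (rule disjCI)
  assume K: "\<not> K \<subseteq> N"
  let ?A = "{c. \<forall>j\<in>X. \<forall>k\<in>K. (c * j) *s k \<in> {0}}"
  let ?B = "{c. \<forall>j\<in>X. \<forall>m\<in>UNIV. (c * j) *s m \<in> N}"
  have "J \<subseteq> ?A \<or> J \<subseteq> ?B"
  proof (rule covered_by_two_subtractive)
    show "J \<subseteq> ?A \<union> ?B"
    proof
      fix c assume c: "c \<in> J"
      have "prod3 scale {c} X K \<subseteq> N"
        using sub c by (simp add: prod3_subset_iff[OF N(1)])
      then have "prod3 scale {c} X K = {0} \<or> prod_ideal {c} X \<subseteq> colon_S scale N"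
        using each[OF c] K by blast
      then show "c \<in> ?A \<union> ?B"
        by (auto simp: prod3_eq_zero_iff prod_ideal_subset_colon_iff[OF N(1)] mem_colon_S)
    qed
    show "subtractive ?A" by (rule subtractive_scalars_into[OF subtractive_zero])
    show "subtractive ?B" by (rule subtractive_scalars_into[OF N(2)])
  qed (rule J)
  moreover have "\<not> J \<subseteq> ?A" using nz by (auto simp: prod3_eq_zero_iff)
  ultimately have "J \<subseteq> ?B" by blast
  then show "prod_ideal J X \<subseteq> colon_S scale N"
    by (auto simp: prod_ideal_subset_colon_iff[OF N(1)] mem_colon_S)
qed

text \<open>
  The condition on ideals is applied to the principal ideals of \<open>a\<close> and \<open>b\<close> and to the cyclic
  subsemimodule of \<open>m\<close>: all their products are multiples of \<open>abm\<close>, which is itself one of them.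
\<close>

lemma absorbing_ideals_imp_weakly_1_absorbing_prime:
  assumes N: "proper_subsemimodule scale N"
    and ideals: "\<And>I J K. proper_ideal I \<Longrightarrow> proper_ideal J \<Longrightarrow> subsemimodule scale K \<Longrightarrow>
      prod3 scale I J K \<noteq> {0} \<Longrightarrow> prod3 scale I J K \<subseteq> N \<Longrightarrow>
      prod_ideal I J \<subseteq> colon_S scale N \<or> K \<subseteq> N"
  shows "weakly_1_absorbing_prime scale N"
  unfolding weakly_1_absorbing_prime_def
proof (intro conjI allI impI)
  show "proper_subsemimodule scale N" by (rule N)
  have sN: "subsemimodule scale N" using N by (simp add: proper_subsemimodule_def)
  fix a b m
  assume ab: "nonunit a" "nonunit b" and nz: "(a * b) *s m \<noteq> 0" and mem: "(a * b) *s m \<in> N"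
  let ?I = "range (\<lambda>s. s * a)" and ?J = "range (\<lambda>s. s * b)" and ?K = "range (\<lambda>s. s *s m)"
  have a: "a \<in> ?I" and b: "b \<in> ?J" by (metis mult_1_left rangeI)+
  have m: "m \<in> ?K" by (metis scale_one rangeI)
  have "prod3 scale ?I ?J ?K \<noteq> {0}"
    using a b m nz unfolding prod3_eq_zero_iff by blast
  moreover have "prod3 scale ?I ?J ?K \<subseteq> N"
  proof -
    have "((s * a) * (t * b)) *s (u *s m) = (s * t * u) *s ((a * b) *s m)" for s t u
      by (simp add: scale_scale ac_simps)
    then show ?thesis using mem sN by (auto simp: prod3_subset_iff[OF sN] subsemimodule_def)
  qed
  ultimately have "prod_ideal ?I ?J \<subseteq> colon_S scale N \<or> ?K \<subseteq> N"
    using ideals ab proper_principal_ideal subsemimodule_cyclic by blast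
  then show "a * b \<in> colon_S scale N \<or> m \<in> N"
    using a b m by (auto simp only: prod_ideal_subset_colon_iff[OF sN])
qed

end

section \<open>The equivalences\<close>

theorem theorem3p4:
  fixes scale :: "'s::comm_semiring_1 \<Rightarrow> 'm::comm_monoid_add \<Rightarrow> 'm"
    and N :: "'m set"
  assumes "semimodule scale"
    and "proper_subsemimodule scale N"
    and "subtractive N"
  shows
    "(weakly_1_absorbing_prime scale N \<longleftrightarrow>
        (\<forall>a b. nonunit a \<longrightarrow> nonunit b \<longrightarrow> a * b \<notin> colon_S scale N \<longrightarrow>
           colon_M scale N (a * b) = colon_M scale {0} (a * b) \<union> N)) \<and>
     (weakly_1_absorbing_prime scale N \<longleftrightarrow>
        (\<forall>a b. nonunit a \<longrightarrow> nonunit b \<longrightarrow> a * b \<notin> colon_S scale N \<longrightarrow>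
           colon_M scale N (a * b) = colon_M scale {0} (a * b) \<or>
           colon_M scale N (a * b) = N)) \<and>
     (weakly_1_absorbing_prime scale N \<longleftrightarrow>
        (\<forall>a b K. nonunit a \<longrightarrow> nonunit b \<longrightarrow> subsemimodule scale K \<longrightarrow>
           prod3 scale {a} {b} K \<noteq> {0} \<longrightarrow> prod3 scale {a} {b} K \<subseteq> N \<longrightarrow>
           a * b \<in> colon_S scale N \<or> K \<subseteq> N)) \<and>
     (weakly_1_absorbing_prime scale N \<longleftrightarrow>
        (\<forall>a J K. nonunit a \<longrightarrow> proper_ideal J \<longrightarrow> subsemimodule scale K \<longrightarrow>
           prod3 scale {a} J K \<noteq> {0} \<longrightarrow> prod3 scale {a} J K \<subseteq> N \<longrightarrow>
           prod_ideal {a} J \<subseteq> colon_S scale N \<or> K \<subseteq> N)) \<and>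
     (weakly_1_absorbing_prime scale N \<longleftrightarrow>
        (\<forall>I J K. proper_ideal I \<longrightarrow> proper_ideal J \<longrightarrow> subsemimodule scale K \<longrightarrow>
           prod3 scale I J K \<noteq> {0} \<longrightarrow> prod3 scale I J K \<subseteq> N \<longrightarrow>
           prod_ideal I J \<subseteq> colon_S scale N \<or> K \<subseteq> N))"
proof -
  interpret semimodule scale by (rule assms(1))
  have N: "subsemimodule scale N" using assms(2) by (simp add: proper_subsemimodule_def)
  let ?P1 = "weakly_1_absorbing_prime scale N"
  let ?P2 = "\<forall>a b. nonunit a \<longrightarrow> nonunit b \<longrightarrow> a * b \<notin> colon_S scale N \<longrightarrow>
    colon_M scale N (a * b) = colon_M scale {0} (a * b) \<union> N"
  let ?P3 = "\<forall>a b. nonunit a \<longrightarrow> nonunit b \<longrightarrow> a * b \<notin> colon_S scale N \<longrightarrow>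
    colon_M scale N (a * b) = colon_M scale {0} (a * b) \<or> colon_M scale N (a * b) = N"
  let ?P4 = "\<forall>a b K. nonunit a \<longrightarrow> nonunit b \<longrightarrow> subsemimodule scale K \<longrightarrow>
    prod3 scale {a} {b} K \<noteq> {0} \<longrightarrow> prod3 scale {a} {b} K \<subseteq> N \<longrightarrow>
    a * b \<in> colon_S scale N \<or> K \<subseteq> N"
  let ?P5 = "\<forall>a J K. nonunit a \<longrightarrow> proper_ideal J \<longrightarrow> subsemimodule scale K \<longrightarrow>
    prod3 scale {a} J K \<noteq> {0} \<longrightarrow> prod3 scale {a} J K \<subseteq> N \<longrightarrow>
    prod_ideal {a} J \<subseteq> colon_S scale N \<or> K \<subseteq> N"
  let ?P6 = "\<forall>I J K. proper_ideal I \<longrightarrow> proper_ideal J \<longrightarrow> subsemimodule scale K \<longrightarrow>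
    prod3 scale I J K \<noteq> {0} \<longrightarrow> prod3 scale I J K \<subseteq> N \<longrightarrow>
    prod_ideal I J \<subseteq> colon_S scale N \<or> K \<subseteq> N"
  have ideal_add: "x + y \<in> I" if "proper_ideal I" "x \<in> I" "y \<in> I" for I :: "'s set" and x y
    using that by (auto simp: proper_ideal_def semiring_ideal_def)
  have 12: "?P1 \<Longrightarrow> ?P2" by (intro allI impI colon_eq_union)
  have 23: "?P2 \<Longrightarrow> ?P3" by (intro allI impI colon_union_imp_eq[OF N assms(3)]) blast
  have 34: "?P3 \<Longrightarrow> ?P4" using colon_dichotomy_imp_absorbing_subsemimodules[OF N] by blast
  have 45: "?P5" if P4: ?P4
  proof (intro allI impI)
    fix a J K
    assume a: "nonunit a" and J: "proper_ideal J" and K: "subsemimodule scale K"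
      and nz: "prod3 scale {a} J K \<noteq> {0}" and sub: "prod3 scale {a} J K \<subseteq> N"
    (* The factors are swapped: the one over which uniformity is gained comes first. *)
    have "prod_ideal J {a} \<subseteq> colon_S scale N \<or> K \<subseteq> N"
    proof (rule absorbing_elements_imp_absorbing_set[OF N assms(3)])
      fix j assume j: "j \<in> J"
        and nz': "prod3 scale {j} {a} K \<noteq> {0}" and sub': "prod3 scale {j} {a} K \<subseteq> N"
      have "j * a \<in> colon_S scale N \<or> K \<subseteq> N"
        using P4 proper_ideal_nonunit[OF J j] a K nz' sub' by blast
      then show "prod_ideal {j} {a} \<subseteq> colon_S scale N \<or> K \<subseteq> N"
        by (simp add: prod_ideal_subset_colon_iff[OF N])
    qed (use nz sub ideal_add[OF J] in
      \<open>simp_all add: prod3_eq_zero_iff prod3_subset_iff[OF N] mult.commute\<close>)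
    then show "prod_ideal {a} J \<subseteq> colon_S scale N \<or> K \<subseteq> N"
      by (simp add: prod_ideal_subset_colon_iff[OF N] mult.commute)
  qed
  have 56: "?P6" if P5: ?P5
  proof (intro allI impI)
    fix I J K
    assume I: "proper_ideal I" and J: "proper_ideal J" and K: "subsemimodule scale K"
      and nz: "prod3 scale I J K \<noteq> {0}" and sub: "prod3 scale I J K \<subseteq> N"
    show "prod_ideal I J \<subseteq> colon_S scale N \<or> K \<subseteq> N"
    proof (rule absorbing_elements_imp_absorbing_set[OF N assms(3) _ _ nz sub])
      show "x + y \<in> I" if "x \<in> I" "y \<in> I" for x y using ideal_add[OF I that] .
      show "prod_ideal {i} J \<subseteq> colon_S scale N \<or> K \<subseteq> N"
        if "i \<in> I" "prod3 scale {i} J K \<noteq> {0}" "prod3 scale {i} J K \<subseteq> N" for i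
        using P5 proper_ideal_nonunit[OF I that(1)] J K that(2,3) by blast
    qed
  qed
  have 61: "?P6 \<Longrightarrow> ?P1"
    by (rule absorbing_ideals_imp_weakly_1_absorbing_prime[OF assms(2)]) blast
  have "?P1 \<longleftrightarrow> ?P2"
    by (rule iffI, intro 12, assumption, intro 61 56 45 34 23, assumption)
  moreover have "?P1 \<longleftrightarrow> ?P3"
    by (rule iffI, intro 23 12, assumption, intro 61 56 45 34, assumption)
  moreover have "?P1 \<longleftrightarrow> ?P4"
    by (rule iffI, intro 34 23 12, assumption, intro 61 56 45, assumption)
  moreover have "?P1 \<longleftrightarrow> ?P5"
    by (rule iffI, intro 45 34 23 12, assumption, intro 61 56, assumption)
  moreover have "?P1 \<longleftrightarrow> ?P6"
    by (rule iffI, intro 56 45 34 23 12, assumption, intro 61, assumption)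
  ultimately show ?thesis by (intro conjI) assumption+
qed

end
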